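(* Let $f_1,\dots,f_n:\mathbb{R}^d\to\mathbb{R}$ be convex, with each $f_i$ $L_i$-smooth ($L_i>0$), let $g:\mathbb{R}^d\to\mathbb{R}$ be convex (possibly non-smooth), let $F=\frac1n\sum_{i=1}^n f_i+g$ and let $x^\star$ be a minimizer of $F$. Let $\eta>0$ be such that $\alpha:=1/(\widetilde L\eta)>2$. Then the output $\widetilde x^S$ of ASVRG for non-strongly convex objectives (described in the context), run with $S\ge1$ epochs of length $m$ and step size $\eta$ from $\widetilde x^0$, satisfies $$\mathbb{E}\left[F(\widetilde x^{S})-F(x^\star)\right]\le\frac{4(\alpha-1)\,[F(\widetilde x^0)-F(x^\star)]}{(\alpha-2)^2(S+1)^2}+\frac{2\|x^\star-\widetilde x^0\|^2}{\eta m(S+1)^2}.$$ Furthermore, choosing $m=\Theta(n)$, the algorithm achieves an $\varepsilon$-suboptimal solution, i.e. $\mathbb{E}[F(\widetilde x^S)]-F(x^\star)\le\varepsilon$, using at most $$\mathcal{O}\left(\frac{n\sqrt{F(\widetilde x^0)-F(x^\star)}}{\sqrt{\varepsilon}}+\frac{\sqrt{n\widetilde L}\,\|\widetilde x^0-x^\star\|}{\sqrt\varepsilon}\right)$$ iterations.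
   Context: $L_i$-smooth means differentiable with $\|\nabla f_i(x)-\nabla f_i(y)\|\le L_i\|x-y\|$ for all $x,y$. $\|\cdot\|$ is the Euclidean norm. $P=(p_1,\dots,p_n)$ is a probability vector with all $p_i>0$, $f=\frac1n\sum_i f_i$, and $\widetilde L:=\max_j L_j/(np_j)$. ASVRG for non-strongly convex objectives, with step size $\eta$, epoch length $m\ge1$, number of epochs $S$, deterministic starting point $\widetilde x^0$: set $\widetilde y^0=\widetilde x^0$ and $\omega_0=1-\frac{\widetilde L\eta}{1-\widetilde L\eta}$. For $s=1,\dots,S$: set $x_0^s=(1-\omega_{s-1})\widetilde x^{s-1}+\omega_{s-1}\widetilde y^{s-1}$, $y_0^s=\widetilde y^{s-1}$; for $t=1,\dots,m$, draw $i_t\in\{1,\dots,n\}$ according to $P$, independently of everything before, and set $$\widetilde\nabla f_{i_t}(x^s_{t-1})=\frac{\nabla f_{i_t}(x^s_{t-1})-\nabla f_{i_t}(\widetilde x^{s-1})}{np_{i_t}}+\nabla f(\widetilde x^{s-1}),$$ $$y_t^s=\arg\min_{y\in\mathbb{R}^d}\Big\{\langle\widetilde\nabla f_{i_t}(x^s_{t-1}),y-y^s_{t-1}\rangle+\frac{\omega_{s-1}}{2\eta}\|y-y^s_{t-1}\|^2+g(y)\Big\},\qquad x_t^s=\widetilde x^{s-1}+\omega_{s-1}(y_t^s-\widetilde x^{s-1});$$ then set $\widetilde x^s=\frac1m\sum_{t=1}^m x_t^s$, $\widetilde y^s=y_m^s$, $\omega_s=\frac12\left(\sqrt{\omega_{s-1}^4+4\omega_{s-1}^2}-\omega_{s-1}^2\right)$.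 Expectations are over all random indices. In the complexity statement, iterations are counted as component gradient evaluations $\nabla f_i(\cdot)$ (each full gradient costs $n$, each inner iteration a constant number); $\alpha>2$ is regarded as a fixed constant, and $\mathcal O$ hides constants depending only on $\alpha$ and on the constants in $m=\Theta(n)$. The number of epochs is chosen depending on $\varepsilon$; $S=0$ means returning $\widetilde x^0$. *)

theory Defs
  imports "HOL-Analysis.Analysis" "HOL-Probability.Probability"
begin

definition gradient :: "(real ^ 'd \<Rightarrow> real) \<Rightarrow> real ^ 'd \<Rightarrow> real ^ 'd" where
  "gradient h x = (THE D. GDERIV h x :> D)"

definition L_smooth :: "real \<Rightarrow> (real ^ 'd \<Rightarrow> real) \<Rightarrow> bool" where
  "L_smooth L h \<longleftrightarrow> (\<forall>x. h differentiable (at x)) \<and>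
     (\<forall>x y. norm (gradient h x - gradient h y) \<le> L * norm (x - y))"

definition average :: "nat \<Rightarrow> (nat \<Rightarrow> real ^ 'd \<Rightarrow> real) \<Rightarrow> real ^ 'd \<Rightarrow> real" where
  "average n f x = (1 / real n) * (\<Sum>i=1..n. f i x)"

definition objective ::
    "nat \<Rightarrow> (nat \<Rightarrow> real ^ 'd \<Rightarrow> real) \<Rightarrow> (real ^ 'd \<Rightarrow> real) \<Rightarrow> real ^ 'd \<Rightarrow> real" where
  "objective n f g x = average n f x + g x"

text \<open>The sampling distribution is a pmf P on the indices 1, ..., n, so that the probability of
  drawing i is \<^term>\<open>pmf P i\<close>.\<close>

definition L_tilde :: "nat \<Rightarrow> nat pmf \<Rightarrow> (nat \<Rightarrow> real) \<Rightarrow> real" where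
  "L_tilde n P L = Max ((\<lambda>j. L j / (real n * pmf P j)) ` {1..n})"

fun momentum :: "real \<Rightarrow> real \<Rightarrow> nat \<Rightarrow> real" where
  "momentum Lt \<eta> 0 = 1 - Lt * \<eta> / (1 - Lt * \<eta>)"
| "momentum Lt \<eta> (Suc s) =
     (sqrt (momentum Lt \<eta> s ^ 4 + 4 * momentum Lt \<eta> s ^ 2) - momentum Lt \<eta> s ^ 2) / 2"

definition vr_gradient ::
    "nat \<Rightarrow> nat pmf \<Rightarrow> (nat \<Rightarrow> real ^ 'd \<Rightarrow> real) \<Rightarrow> real ^ 'd \<Rightarrow> nat \<Rightarrow> real ^ 'd \<Rightarrow> real ^ 'd" where
  "vr_gradient n P f xt i x =
     (1 / (real n * pmf P i)) *\<^sub>R (gradient (f i) x - gradient (f i) xt)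
       + gradient (average n f) xt"

definition prox_step ::
    "(real ^ 'd \<Rightarrow> real) \<Rightarrow> real \<Rightarrow> real \<Rightarrow> real ^ 'd \<Rightarrow> real ^ 'd \<Rightarrow> real ^ 'd" where
  "prox_step g \<eta> w v y0 =
     arg_min (\<lambda>y. v \<bullet> (y - y0) + w / (2 * \<eta>) * (norm (y - y0))\<^sup>2 + g y) (\<lambda>_. True)"

text \<open>Joint law of \<open>(x\<^sub>t, y\<^sub>t, x\<^sub>1 + \<dots> + x\<^sub>t)\<close> after \<open>t\<close> inner iterations of an epoch with snapshot
  \<open>xt\<close>, starting value \<open>y\<^sub>0 = yt\<close> and momentum parameter \<open>w\<close>. Each iteration draws a fresh index
  from \<open>P\<close>.\<close>

fun asvrg_inner ::
    "nat \<Rightarrow> nat pmf \<Rightarrow> (nat \<Rightarrow> real ^ 'd \<Rightarrow> real) \<Rightarrow> (real ^ 'd \<Rightarrow> real) \<Rightarrow> real \<Rightarrow> real \<Rightarrow>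
     real ^ 'd \<Rightarrow> real ^ 'd \<Rightarrow> nat \<Rightarrow> ((real ^ 'd) \<times> (real ^ 'd) \<times> (real ^ 'd)) pmf" where
  "asvrg_inner n P f g \<eta> w xt yt 0 =
     return_pmf ((1 - w) *\<^sub>R xt + w *\<^sub>R yt, yt, 0)"
| "asvrg_inner n P f g \<eta> w xt yt (Suc t) =
     bind_pmf (asvrg_inner n P f g \<eta> w xt yt t) (\<lambda>(x, y, a).
     bind_pmf P (\<lambda>i.
       let y' = prox_step g \<eta> w (vr_gradient n P f xt i x) y;
           x' = xt + w *\<^sub>R (y' - xt)
       in return_pmf (x', y', a + x')))"

text \<open>Joint law of the snapshot and the auxiliary point after \<open>s\<close> epochs of length \<open>m\<close> (both start at
  \<open>x0\<close>).\<close>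

fun asvrg ::
    "nat \<Rightarrow> nat pmf \<Rightarrow> (nat \<Rightarrow> real ^ 'd \<Rightarrow> real) \<Rightarrow> (nat \<Rightarrow> real) \<Rightarrow> (real ^ 'd \<Rightarrow> real) \<Rightarrow> real \<Rightarrow>
     nat \<Rightarrow> real ^ 'd \<Rightarrow> nat \<Rightarrow> ((real ^ 'd) \<times> (real ^ 'd)) pmf" where
  "asvrg n P f L g \<eta> m x0 0 = return_pmf (x0, x0)"
| "asvrg n P f L g \<eta> m x0 (Suc s) =
     bind_pmf (asvrg n P f L g \<eta> m x0 s) (\<lambda>(xt, yt).
     map_pmf (\<lambda>(x, y, a). ((1 / real m) *\<^sub>R a, y))
       (asvrg_inner n P f g \<eta> (momentum (L_tilde n P L) \<eta> s) xt yt m))"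

definition asvrg_output ::
    "nat \<Rightarrow> nat pmf \<Rightarrow> (nat \<Rightarrow> real ^ 'd \<Rightarrow> real) \<Rightarrow> (nat \<Rightarrow> real) \<Rightarrow> (real ^ 'd \<Rightarrow> real) \<Rightarrow> real \<Rightarrow>
     nat \<Rightarrow> real ^ 'd \<Rightarrow> nat \<Rightarrow> (real ^ 'd) pmf" where
  "asvrg_output n P f L g \<eta> m x0 S = map_pmf fst (asvrg n P f L g \<eta> m x0 S)"

text \<open>Number of component gradient evaluations in \<open>S\<close> epochs: per epoch, \<open>n\<close> for the full gradient at
  the snapshot and two for each of the \<open>m\<close> variance-reduced gradients.\<close>

definition asvrg_evals :: "nat \<Rightarrow> nat \<Rightarrow> nat \<Rightarrow> nat" where
  "asvrg_evals n m S = S * (n + 2 * m)"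

text \<open>The constant hidden in the complexity bound, for \<open>a * n \<le> m \<le> b * n\<close>. An existentially
  quantified constant inside a theorem about \<^typ>\<open>real ^ 'd\<close> could depend on the dimension, since
  that is a type; the explicit function depends on \<open>\<alpha>\<close>, \<open>a\<close>, \<open>b\<close> only.\<close>

definition complexity_const :: "real \<Rightarrow> real \<Rightarrow> real \<Rightarrow> real" where
  "complexity_const \<alpha> a b =
     (1 + 2 * b) * (1 + 2 * sqrt (\<alpha> - 1) / (\<alpha> - 2) + sqrt (2 * \<alpha> / a))"

end

theory Submission
  imports Defs
begin

text \<open>Each inner iteration is a mirror-descent step on an upper model of the objective. The descent
  lemma together with Young's inequality trades the gradient noise for \<open>\<beta> = 1 / (\<alpha> - 1)\<close> times the Bregman
  divergence of the smooth part between the snapshot and the current point. Since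
  \<open>x = (1 - w) xt + w y\<close>, the linear terms recombine into tangent-plane bounds at \<open>x_star\<close> and \<open>xt\<close> with
  weights \<open>w\<close> and \<open>1 - w - \<beta>\<close>, so that the divergence cancels as soon as \<open>w \<le> 1 - \<beta>\<close>, which is the
  choice of \<open>\<omega>\<^sub>0\<close>. Averaged over an epoch this gives
  \<open>E \<Phi>\<^sub>s / w\<^sup>2 + E D\<^sub>s / (2 \<eta> m) \<le> (1 - w) / w\<^sup>2 * \<Phi>\<^sub>s\<^sub>-\<^sub>1 + D\<^sub>s\<^sub>-\<^sub>1 / (2 \<eta> m)\<close> for the gap \<open>\<Phi>\<close> and the squared
  distance \<open>D\<close> of the auxiliary point to the minimizer. The recursion for \<open>\<omega>\<close> is exactly
  \<open>(1 - \<omega>\<^sub>s) / \<omega>\<^sub>s\<^sup>2 = 1 / \<omega>\<^sub>s\<^sub>-\<^sub>1\<^sup>2\<close>, so the bounds telescope, and \<open>\<omega>\<^sub>s \<le> 2 / (s + 2)\<close>.\<close>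

section \<open>Gradients, tangent planes and smoothness inequalities\<close>

text \<open>Riesz representation in finite dimension: the representing vector has the values of the
  functional on the orthonormal basis as coordinates.\<close>

lemma has_derivative_imp_GDERIV:
  fixes h :: "'a::euclidean_space \<Rightarrow> real"
  assumes "(h has_derivative h') (at x)"
  shows "GDERIV h x :> (\<Sum>b\<in>Basis. h' b *\<^sub>R b)"
proof -
  have lin: "linear h'"
    using assms has_derivative_linear by blast
  have "h' v = v \<bullet> (\<Sum>b\<in>Basis. h' b *\<^sub>R b)" for v
  proof -
    have "h' v = h' (\<Sum>b\<in>Basis. (v \<bullet> b) *\<^sub>R b)"
      by (simp add: euclidean_representation)
    also have "\<dots> = (\<Sum>b\<in>Basis. (v \<bullet> b) * h' b)"
      by (simp add: linear_sum[OF lin] linear_cmul[OF lin])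
    finally show ?thesis
      by (simp add: inner_sum_right mult.commute)
  qed
  then have "h' = (\<lambda>v. v \<bullet> (\<Sum>b\<in>Basis. h' b *\<^sub>R b))"
    by blast
  with assms show ?thesis
    unfolding gderiv_def by metis
qed

text \<open>Makes the definite description in \<open>gradient\<close> well defined.\<close>

lemma GDERIV_unique:
  assumes "GDERIV h x :> D" "GDERIV h x :> E"
  shows "D = E"
proof -
  have "(\<lambda>v. v \<bullet> D) = (\<lambda>v. v \<bullet> E)"
    using assms has_derivative_unique unfolding gderiv_def by blast
  then have "(D - E) \<bullet> D = (D - E) \<bullet> E"
    by metis
  then have "(D - E) \<bullet> (D - E) = 0"
    by (simp add: inner_diff_right)
  then show ?thesis
    by simp
qed

lemma gradient_eqI: "GDERIV h x :> D \<Longrightarrow> gradient h x = D"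
  unfolding gradient_def using GDERIV_unique by blast

lemma GDERIV_gradient: "h differentiable (at x) \<Longrightarrow> GDERIV h x :> gradient h x"
  using gradient_eqI has_derivative_imp_GDERIV unfolding differentiable_def by metis

lemma GDERIV_along_line:
  fixes h :: "'a::real_inner \<Rightarrow> real"
  assumes "GDERIV h (x + t *\<^sub>R d) :> D"
  shows "((\<lambda>t. h (x + t *\<^sub>R d)) has_real_derivative (d \<bullet> D)) (at t)"
proof -
  have "((\<lambda>t. x + t *\<^sub>R d) has_derivative (\<lambda>u. u *\<^sub>R d)) (at t)"
    by (auto intro!: derivative_eq_intros)
  moreover have "(h has_derivative (\<lambda>v. v \<bullet> D)) (at (x + t *\<^sub>R d))"
    using assms by (simp add: gderiv_def)
  ultimately have "((\<lambda>t. h (x + t *\<^sub>R d)) has_derivative (\<lambda>u. (u *\<^sub>R d) \<bullet> D)) (at t)"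
    by (rule has_derivative_compose)
  then show ?thesis
    unfolding has_field_derivative_def by (rule has_derivative_eq_rhs) (simp add: fun_eq_iff)
qed

text \<open>Restriction to the line through \<open>x\<close> and \<open>y\<close> reduces this to
  the tangent inequality for convex functions of one real variable.\<close>

lemma convex_above_tangent_plane:
  fixes h :: "'a::real_inner \<Rightarrow> real"
  assumes conv: "convex_on UNIV h" and deriv: "GDERIV h x :> D"
  shows "h x + D \<bullet> (y - x) \<le> h y"
proof -
  let ?\<phi> = "\<lambda>t. h (x + t *\<^sub>R (y - x))"
  have "convex_on UNIV ?\<phi>"
  proof (rule convex_onI)
    fix t u v :: real
    assume "0 < t" "t < 1"
    then have "h ((1 - t) *\<^sub>R (x + u *\<^sub>R (y - x)) + t *\<^sub>R (x + v *\<^sub>R (y - x)))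
        \<le> (1 - t) * ?\<phi> u + t * ?\<phi> v"
      by (intro convex_onD[OF conv]) auto
    then show "?\<phi> ((1 - t) *\<^sub>R u + t *\<^sub>R v) \<le> (1 - t) * ?\<phi> u + t * ?\<phi> v"
      by (simp add: algebra_simps)
  qed auto
  moreover have "(?\<phi> has_real_derivative ((y - x) \<bullet> D)) (at 0)"
    by (rule GDERIV_along_line) (simp add: deriv)
  ultimately have "?\<phi> 1 - ?\<phi> 0 \<ge> ((y - x) \<bullet> D) * (1 - 0)"
    by (intro convex_on_imp_above_tangent[where A = UNIV]) auto
  then show ?thesis
    by (simp add: inner_commute)
qed

lemma descent_lemma:
  fixes h :: "'a::real_inner \<Rightarrow> real"
  assumes deriv: "\<And>z. GDERIV h z :> G z"
    and lip: "\<And>y z. norm (G y - G z) \<le> K * norm (y - z)"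
  shows "h y \<le> h x + G x \<bullet> (y - x) + K / 2 * (norm (y - x))\<^sup>2"
proof -
  define d where "d = y - x"
  let ?\<psi> = "\<lambda>t. h (x + t *\<^sub>R d) - t * (d \<bullet> G x) - K / 2 * t\<^sup>2 * (norm d)\<^sup>2"
  have "?\<psi> 0 \<ge> ?\<psi> 1"
  proof (rule DERIV_nonpos_imp_nonincreasing[where f = ?\<psi>])
    fix t :: real
    assume t: "0 \<le> t" "t \<le> 1"
    let ?D = "d \<bullet> G (x + t *\<^sub>R d) - d \<bullet> G x - K * t * (norm d)\<^sup>2"
    have "(?\<psi> has_real_derivative ?D) (at t)"
      by (rule derivative_eq_intros GDERIV_along_line deriv refl | simp)+
    moreover have "d \<bullet> (G (x + t *\<^sub>R d) - G x) \<le> norm d * norm (G (x + t *\<^sub>R d) - G x)"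
      by (rule norm_cauchy_schwarz)
    then have "d \<bullet> (G (x + t *\<^sub>R d) - G x) \<le> norm d * (K * norm (t *\<^sub>R d))"
      using mult_left_mono[OF lip[of "x + t *\<^sub>R d" x], of "norm d"] by simp
    then have "?D \<le> 0"
      using t by (simp add: inner_diff_right power2_eq_square mult.assoc mult.left_commute)
    ultimately show "\<exists>D. (?\<psi> has_real_derivative D) (at t) \<and> D \<le> 0"
      by blast
  qed simp
  then show ?thesis
    by (simp add: d_def inner_commute)
qed

text \<open>Two bounds on \<open>h\<close> at one trial point are compared: the tangent plane at
  \<open>x\<close> from below and the quadratic model at \<open>y\<close> from above.\<close>

lemma gradient_diff_norm_le_bregman:
  fixes h :: "'a::real_inner \<Rightarrow> real"
  assumes conv: "convex_on UNIV h" and deriv: "\<And>z. GDERIV h z :> G z"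
    and lip: "\<And>y z. norm (G y - G z) \<le> K * norm (y - z)" and K: "K > 0"
  shows "(norm (G x - G y))\<^sup>2 \<le> 2 * K * (h y - h x - G x \<bullet> (y - x))"
proof -
  define e where "e = G y - G x"
  \<comment> \<open>This \<open>z\<close> minimizes the quadratic upper model at \<open>y\<close>
    minus the linear function with slope \<open>G x\<close>, so the comparison is sharpest
    here.\<close>
  define z where "z = y - (1 / K) *\<^sub>R e"
  have "h x + G x \<bullet> (z - x) \<le> h z"
    by (rule convex_above_tangent_plane[OF conv deriv])
  moreover have "h z \<le> h y + G y \<bullet> (z - y) + K / 2 * (norm (z - y))\<^sup>2"
    by (rule descent_lemma[OF deriv lip])
  moreover have "G x \<bullet> (z - x) = G x \<bullet> (y - x) - (1 / K) * (G x \<bullet> e)"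
    by (simp add: z_def inner_diff_right)
  moreover have "G y \<bullet> (z - y) = - (1 / K) * (G y \<bullet> e)"
    by (simp add: z_def)
  moreover have "K / 2 * (norm (z - y))\<^sup>2 = (norm e)\<^sup>2 / (2 * K)"
    using K by (simp add: z_def power_divide field_simps power2_eq_square)
  moreover have "(1 / K) * (G y \<bullet> e) - (1 / K) * (G x \<bullet> e) = (norm e)\<^sup>2 / K"
    by (simp add: e_def inner_diff_left[symmetric] diff_divide_distrib[symmetric] power2_norm_eq_inner)
  moreover have "(norm e)\<^sup>2 / K = 2 * ((norm e)\<^sup>2 / (2 * K))"
    using K by simp
  ultimately have "(norm e)\<^sup>2 / (2 * K) \<le> h y - h x - G x \<bullet> (y - x)"
    by linarith
  then have "(norm e)\<^sup>2 \<le> 2 * K * (h y - h x - G x \<bullet> (y - x))"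
    using K by (simp add: field_simps)
  then show ?thesis
    by (simp add: e_def norm_minus_commute)
qed

section \<open>Minimizing a convex function plus a quadratic\<close>

text \<open>A convex function is bounded below on the unit ball around \<open>c\<close>; by convexity along rays it then
  decreases at most linearly, which the quadratic term dominates.\<close>
lemma convex_plus_quadratic_has_minimum:
  fixes h :: "'a::euclidean_space \<Rightarrow> real"
  assumes conv: "convex_on UNIV h" and k: "k > 0"
  shows "\<exists>z. \<forall>y. h z + k * (norm (z - c))\<^sup>2 \<le> h y + k * (norm (y - c))\<^sup>2"
proof -
  let ?\<phi> = "\<lambda>y. h y + k * (norm (y - c))\<^sup>2"
  have cont: "continuous_on A h" for A
    using convex_on_continuous[OF open_UNIV conv] continuous_on_subset by blast
  have "compact (cball c 1)" "cball c 1 \<noteq> {}"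
    by auto
  from continuous_attains_inf[OF this cont] obtain b where
    b: "\<And>y. y \<in> cball c 1 \<Longrightarrow> h b \<le> h y"
    by blast
  define M where "M = h c - h b"
  have M: "M \<ge> 0"
    using b[of c] by (simp add: M_def)
  \<comment> \<open>At distance r \<ge> R the possible linear loss \<open>r * M\<close> is at most
    \<open>k * r\<^sup>2\<close>. The maximum with 1 keeps \<open>1 / r\<close> a convex weight; the
    point with that weight lies at distance 1 from \<open>c\<close>.\<close>
  define R where "R = max 1 (M / k)"
  have R: "R \<ge> 1" "M \<le> k * R"
    using k by (auto simp: R_def max_def field_simps)
  have far: "?\<phi> c \<le> ?\<phi> y" if y: "norm (y - c) \<ge> R" for y
  proof -
    define r where "r = norm (y - c)"
    have r: "r \<ge> R" "r \<ge> 1"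
      using y R by (auto simp: r_def)
    have "h ((1 - 1 / r) *\<^sub>R c + (1 / r) *\<^sub>R y) \<le> (1 - 1 / r) * h c + (1 / r) * h y"
      using r by (intro convex_onD[OF conv]) auto
    moreover have "dist c ((1 - 1 / r) *\<^sub>R c + (1 / r) *\<^sub>R y) = norm ((1 / r) *\<^sub>R (y - c))"
      by (simp add: dist_norm norm_minus_commute algebra_simps)
    then have "(1 - 1 / r) *\<^sub>R c + (1 / r) *\<^sub>R y \<in> cball c 1"
      using r by (simp add: r_def)
    then have "h b \<le> h ((1 - 1 / r) *\<^sub>R c + (1 / r) *\<^sub>R y)"
      by (rule b)
    ultimately have "h b \<le> (1 - 1 / r) * h c + (1 / r) * h y"
      by linarith
    then have "r * h b \<le> r * ((1 - 1 / r) * h c + (1 / r) * h y)"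
      using r by (intro mult_left_mono) auto
    also have "\<dots> = (r - 1) * h c + h y"
      using r by (simp add: field_simps)
    finally have "h c - r * M \<le> h y"
      by (simp add: M_def algebra_simps)
    moreover have "r * M \<le> k * r\<^sup>2"
    proof -
      have "M \<le> k * r"
        using R r k mult_left_mono[of R r k] by linarith
      then have "r * M \<le> r * (k * r)"
        using r by (intro mult_left_mono) auto
      then show ?thesis
        by (simp add: power2_eq_square mult.left_commute)
    qed
    ultimately show ?thesis
      by (simp add: r_def)
  qed
  have "compact (cball c R)" "cball c R \<noteq> {}" "continuous_on (cball c R) ?\<phi>"
    using R by (auto intro!: continuous_intros cont)
  from continuous_attains_inf[OF this] obtain z where
    z: "\<And>y. y \<in> cball c R \<Longrightarrow> ?\<phi> z \<le> ?\<phi> y"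
    by blast
  have "?\<phi> z \<le> ?\<phi> y" for y
  proof (cases "y \<in> cball c R")
    case False
    then have "?\<phi> c \<le> ?\<phi> y"
      by (intro far) (simp add: dist_norm norm_minus_commute)
    moreover have "?\<phi> z \<le> ?\<phi> c"
      using R by (intro z) auto
    ultimately show ?thesis
      by linarith
  qed (rule z)
  then show ?thesis
    by blast
qed

lemma norm_sq_convex_combination:
  fixes a b :: "'a::real_inner"
  shows "(norm ((1 - t) *\<^sub>R a + t *\<^sub>R b))\<^sup>2
    = (1 - t) * (norm a)\<^sup>2 + t * (norm b)\<^sup>2 - t * (1 - t) * (norm (a - b))\<^sup>2"
  by (simp add: power2_norm_eq_inner inner_add_left inner_add_right inner_diff_left
      inner_diff_right inner_commute[of b a] algebra_simps)

text \<open>Strong convexity contributed by the quadratic: the minimizer is compared with the point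
  at fraction t on the way to \<open>u\<close>, the inequality is divided by t, and t tends to
  0.\<close>

lemma convex_plus_quadratic_three_point:
  fixes h :: "'a::real_inner \<Rightarrow> real"
  assumes conv: "convex_on UNIV h"
    and min: "\<And>y. h z + k * (norm (z - c))\<^sup>2 \<le> h y + k * (norm (y - c))\<^sup>2"
  shows "h z + k * (norm (z - c))\<^sup>2 + k * (norm (u - z))\<^sup>2 \<le> h u + k * (norm (u - c))\<^sup>2"
proof -
  define A where "A = h u + k * (norm (u - c))\<^sup>2 - (h z + k * (norm (z - c))\<^sup>2)"
  define B where "B = k * (norm (u - z))\<^sup>2"
  have "(1 - t) * B \<le> A" if t: "0 < t" "t < 1" for t
  proof -
    define y where "y = (1 - t) *\<^sub>R z + t *\<^sub>R u"
    have "h y \<le> (1 - t) * h z + t * h u"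
      unfolding y_def using t by (intro convex_onD[OF conv]) auto
    moreover have "y - c = (1 - t) *\<^sub>R (z - c) + t *\<^sub>R (u - c)"
      by (simp add: y_def algebra_simps)
    then have "(norm (y - c))\<^sup>2 = (1 - t) * (norm (z - c))\<^sup>2 + t * (norm (u - c))\<^sup>2
        - t * (1 - t) * (norm (u - z))\<^sup>2"
      using norm_sq_convex_combination[of t "z - c" "u - c"] by (simp add: norm_minus_commute)
    ultimately have "h z + k * (norm (z - c))\<^sup>2 \<le> (1 - t) * h z + t * h u
        + k * ((1 - t) * (norm (z - c))\<^sup>2 + t * (norm (u - c))\<^sup>2 - t * (1 - t) * (norm (u - z))\<^sup>2)"
      using min[of y] by simp
    then have "t * ((1 - t) * B) \<le> t * A"
      by (simp add: A_def B_def algebra_simps)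
    then show ?thesis
      using t by simp
  qed
  \<comment> \<open>The factor 1 - t is removed by letting t tend to 0 from the right; t = 0 itself
    gives no information, since the division by t is impossible there.\<close>
  then have "eventually (\<lambda>t. (1 - t) * B \<le> A) (at_right 0)"
    using eventually_at_right_less[of "0::real"] eventually_at_right_field[of _ "0::real"]
    by (auto intro!: exI[of _ 1])
  moreover have "((\<lambda>t. (1 - t) * B) \<longlongrightarrow> (1 - 0) * B) (at_right 0)"
    by (intro tendsto_intros)
  ultimately have "(1 - 0) * B \<le> A"
    by (intro tendsto_upperbound) auto
  then show ?thesis
    by (simp add: A_def B_def)
qed

section \<open>Expectations over finitely supported laws\<close>

text \<open>The tower rule. Finite supports turn all integrals into finite sums, so integrability is
  automatic.\<close>

lemma expectation_bind_pmf:
  fixes h :: "'b \<Rightarrow> real"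
  assumes "finite (set_pmf p)" "\<And>x. x \<in> set_pmf p \<Longrightarrow> finite (set_pmf (k x))"
  shows "measure_pmf.expectation (bind_pmf p k) h
    = measure_pmf.expectation p (\<lambda>x. measure_pmf.expectation (k x) h)"
  using assms
  by (simp add: pmf_expectation_bind[of "set_pmf p"] integral_measure_pmf[of "set_pmf p"])

lemma expectation_mono_pmf:
  fixes h k :: "'a \<Rightarrow> real"
  assumes "finite (set_pmf p)" "\<And>x. x \<in> set_pmf p \<Longrightarrow> h x \<le> k x"
  shows "measure_pmf.expectation p h \<le> measure_pmf.expectation p k"
  using assms
  by (intro integral_mono_AE) (auto simp: AE_measure_pmf_iff intro: integrable_measure_pmf_finite)

section \<open>One step of the momentum recursion\<close>

text \<open>The formula is the positive root of \<open>w'\<^sup>2 = w\<^sup>2 * (1 - w')\<close>,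
  which yields the ratio identity. Completing the square in \<open>1 / w'\<close> turns that
  identity into \<open>(1 / w' - 1 / 2)\<^sup>2 = 1 / w\<^sup>2 + 1 / 4\<close>, whence the growth
  by 1/2.\<close>

lemma momentum_step:
  fixes w :: real
  assumes w: "w > 0" and w': "w' = (sqrt (w ^ 4 + 4 * w\<^sup>2) - w\<^sup>2) / 2"
  shows "w' > 0" "w' \<le> w" "(1 - w') / w'\<^sup>2 = 1 / w\<^sup>2" "1 / w' \<ge> 1 / w + 1 / 2"
proof -
  define r where "r = sqrt (w ^ 4 + 4 * w\<^sup>2)"
  have r2: "r\<^sup>2 = w ^ 4 + 4 * w\<^sup>2"
    by (simp add: r_def)
  have w'r: "w' = (r - w\<^sup>2) / 2"
    by (simp add: w' r_def)
  have "w\<^sup>2 < r"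
    unfolding r_def using w by (intro real_less_rsqrt) (simp add: power2_eq_square power4_eq_xxxx)
  then show pos: "w' > 0"
    by (simp add: w'r)
  have "r = 2 * w' + w\<^sup>2"
    using w'r by (simp add: field_simps)
  then have "(2 * w' + w\<^sup>2)\<^sup>2 = (w\<^sup>2)\<^sup>2 + 4 * w\<^sup>2"
    using r2 by simp
  then have eq: "w'\<^sup>2 = w\<^sup>2 * (1 - w')"
    by (simp add: power2_sum right_diff_distrib mult.commute[of "w\<^sup>2" w'])
  then have "0 < 1 - w'"
    using zero_less_power[OF pos, of 2] zero_less_power[OF w, of 2] by (simp add: zero_less_mult_iff)
  then have lt1: "w' < 1"
    by simp
  have "w\<^sup>2 * (1 - w') \<le> w\<^sup>2 * 1"
    using pos by (intro mult_left_mono) auto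
  then have "w'\<^sup>2 \<le> w\<^sup>2"
    by (simp add: eq)
  then show "w' \<le> w"
    by (rule power2_le_imp_le) (use w in simp)
  have "(1 - w') / w'\<^sup>2 = (1 - w') / (w\<^sup>2 * (1 - w'))"
    by (simp only: eq)
  also have "\<dots> = 1 / w\<^sup>2"
    using lt1 by simp
  finally show ratio: "(1 - w') / w'\<^sup>2 = 1 / w\<^sup>2" .
  have "(1 - w') / w'\<^sup>2 = 1 / w'\<^sup>2 - 1 / w'"
    using pos by (simp add: diff_divide_distrib power2_eq_square)
  moreover have "(1 / w' - 1 / 2)\<^sup>2 = 1 / w'\<^sup>2 - 1 / w' + 1 / 4"
    by (simp add: power2_diff power_divide)
  moreover have "(1 / w)\<^sup>2 = (1 - w') / w'\<^sup>2"
    unfolding ratio by (rule power_one_over)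
  ultimately have "(1 / w)\<^sup>2 \<le> (1 / w' - 1 / 2)\<^sup>2"
    by linarith
  moreover have "1 / w' \<ge> 1"
    using pos lt1 by simp
  ultimately have "1 / w \<le> 1 / w' - 1 / 2"
    by (intro power2_le_imp_le[of "1 / w"]) auto
  then show "1 / w' \<ge> 1 / w + 1 / 2"
    by simp
qed

text \<open>The two sides differ by the squared norm of the mean.\<close>

lemma weighted_variance_le_second_moment:
  fixes a :: "'i \<Rightarrow> 'a::real_inner" and p :: "'i \<Rightarrow> real"
  assumes p: "sum p I = 1"
  shows "(\<Sum>i\<in>I. p i * (norm (a i - (\<Sum>j\<in>I. p j *\<^sub>R a j)))\<^sup>2) \<le> (\<Sum>i\<in>I. p i * (norm (a i))\<^sup>2)"
proof -
  define \<mu> where "\<mu> = (\<Sum>j\<in>I. p j *\<^sub>R a j)"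
  have "(\<Sum>i\<in>I. p i * (norm (a i - \<mu>))\<^sup>2)
      = (\<Sum>i\<in>I. p i * (norm (a i))\<^sup>2 - 2 * (p i * (a i \<bullet> \<mu>)) + p i * (norm \<mu>)\<^sup>2)"
    by (intro sum.cong refl)
      (simp add: power2_norm_eq_inner inner_diff_left inner_diff_right inner_commute[of \<mu> "a _"]
        distrib_left right_diff_distrib)
  also have "\<dots> = (\<Sum>i\<in>I. p i * (norm (a i))\<^sup>2) - 2 * (\<Sum>i\<in>I. p i * (a i \<bullet> \<mu>)) + sum p I * (norm \<mu>)\<^sup>2"
    by (simp add: sum.distrib sum_subtractf sum_distrib_left sum_distrib_right)
  also have "(\<Sum>i\<in>I. p i * (a i \<bullet> \<mu>)) = \<mu> \<bullet> \<mu>"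
    by (simp add: \<mu>_def inner_sum_left)
  finally show ?thesis
    by (simp add: p \<mu>_def[symmetric] power2_norm_eq_inner)
qed

section \<open>Problem data and smoothness of the average\<close>

locale asvrg_problem =
  fixes n :: nat and f :: "nat \<Rightarrow> real ^ 'd \<Rightarrow> real" and g :: "real ^ 'd \<Rightarrow> real"
    and L :: "nat \<Rightarrow> real" and P :: "nat pmf" and \<eta> \<alpha> :: real
    and x_star :: "real ^ 'd"
  assumes f_convex: "\<And>i. i \<in> {1..n} \<Longrightarrow> convex_on UNIV (f i)"
    and L_pos: "\<And>i. i \<in> {1..n} \<Longrightarrow> L i > 0"
    and f_smooth: "\<And>i. i \<in> {1..n} \<Longrightarrow> L_smooth (L i) (f i)"
    and g_convex: "convex_on UNIV g"
    and minimizer: "is_arg_min (objective n f g) (\<lambda>_. True) x_star"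
    and P_support: "set_pmf P = {1..n}"
    and eta_pos: "\<eta> > 0"
    and alpha_def: "\<alpha> = 1 / (L_tilde n P L * \<eta>)"
    and alpha_gt: "\<alpha> > 2"
begin

abbreviation "Lt \<equiv> L_tilde n P L"
abbreviation "favg \<equiv> average n f"
abbreviation "F \<equiv> objective n f g"
abbreviation "\<omega> \<equiv> momentum Lt \<eta>"
text \<open>This is \<beta> = Lt * \<eta> / (1 - Lt * \<eta>), so that \<omega> starts at 1 -
  \<beta>; it is also the factor in front of the Bregman divergence that pays for the gradient
  noise.\<close>

abbreviation "\<beta> \<equiv> 1 / (\<alpha> - 1)"

lemma n_pos: "n > 0"
  using set_pmf_not_empty[of P] P_support by (cases n) auto

lemma finite_P: "finite (set_pmf P)"
  by (simp add: P_support)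

lemma sum_P: "(\<Sum>i=1..n. pmf P i) = 1"
  by (simp add: sum_pmf_eq_1 P_support)

lemma pmf_P_pos: "i \<in> {1..n} \<Longrightarrow> pmf P i > 0"
  by (rule pmf_positive) (simp add: P_support)

lemma expectation_P:
  fixes h :: "nat \<Rightarrow> real"
  shows "measure_pmf.expectation P h = (\<Sum>i=1..n. pmf P i * h i)"
  using integral_measure_pmf[of "{1..n}" P h] by (simp add: P_support)

lemma Lt_eta: "Lt * \<eta> = 1 / \<alpha>"
  by (simp add: alpha_def)

lemma Lt_eq: "Lt = 1 / (\<alpha> * \<eta>)"
proof -
  have "Lt = (Lt * \<eta>) / \<eta>"
    using eta_pos by simp
  then show ?thesis
    unfolding Lt_eta by simp
qed

lemma Lt_pos: "Lt > 0"
  using eta_pos alpha_gt by (simp add: Lt_eq)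

lemma L_le: "i \<in> {1..n} \<Longrightarrow> L i / real n \<le> Lt * pmf P i"
proof -
  assume i: "i \<in> {1..n}"
  then have "L i / (real n * pmf P i) \<le> Lt"
    unfolding L_tilde_def by (intro Max_ge) auto
  then show ?thesis
    using pmf_P_pos[OF i] n_pos by (simp add: field_simps)
qed

lemma GDERIV_f: "i \<in> {1..n} \<Longrightarrow> GDERIV (f i) x :> gradient (f i) x"
  using f_smooth by (intro GDERIV_gradient) (auto simp: L_smooth_def)

lemma gradient_f_lipschitz:
  "i \<in> {1..n} \<Longrightarrow> norm (gradient (f i) x - gradient (f i) y) \<le> L i * norm (x - y)"
  using f_smooth by (auto simp: L_smooth_def)

lemma GDERIV_favg_sum: "GDERIV favg x :> (1 / real n) *\<^sub>R (\<Sum>i=1..n. gradient (f i) x)"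
proof -
  have "((\<lambda>x. \<Sum>i=1..n. f i x) has_derivative (\<lambda>h. \<Sum>i=1..n. h \<bullet> gradient (f i) x)) (at x)"
    using GDERIV_f by (intro has_derivative_sum) (auto simp: gderiv_def)
  then have "((\<lambda>x. (1 / real n) * (\<Sum>i=1..n. f i x))
      has_derivative (\<lambda>h. (1 / real n) * (\<Sum>i=1..n. h \<bullet> gradient (f i) x))) (at x)"
    by (rule has_derivative_mult_right)
  then show ?thesis
    by (simp add: gderiv_def average_def[abs_def] inner_sum_right)
qed

lemma gradient_favg: "gradient favg x = (1 / real n) *\<^sub>R (\<Sum>i=1..n. gradient (f i) x)"
  by (rule gradient_eqI) (rule GDERIV_favg_sum)

lemma GDERIV_favg: "GDERIV favg x :> gradient favg x"
  unfolding gradient_favg by (rule GDERIV_favg_sum)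

lemma convex_favg: "convex_on UNIV favg"
proof -
  have "convex_on UNIV (\<lambda>x. \<Sum>i\<in>A. f i x)" if "A \<subseteq> {1..n}" for A
    using finite_subset[OF that finite_atLeastAtMost] that
    by (induction A rule: finite_induct) (auto intro!: f_convex convex_on_add simp: convex_on_const)
  then show ?thesis
    unfolding average_def[abs_def] by (intro convex_on_cmul) auto
qed

lemma convex_F: "convex_on UNIV F"
  unfolding objective_def[abs_def] by (intro convex_on_add convex_favg g_convex)

lemma F_min: "F x_star \<le> F x"
  using minimizer by (simp add: is_arg_min_linorder)

text \<open>Each \<open>L i / n\<close> is at most \<open>Lt * pmf P i\<close>, and the
  probabilities sum to 1. Hence the one constant \<open>Lt\<close> governs both the smoothness of
  the average and the sampling noise.\<close>

lemma gradient_favg_lipschitz: "norm (gradient favg x - gradient favg y) \<le> Lt * norm (x - y)"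
proof -
  have "gradient favg x - gradient favg y
      = (\<Sum>i=1..n. (1 / real n) *\<^sub>R (gradient (f i) x - gradient (f i) y))"
    by (simp add: gradient_favg scaleR_right_diff_distrib sum_subtractf scaleR_sum_right)
  also have "norm \<dots> \<le> (\<Sum>i=1..n. Lt * pmf P i * norm (x - y))"
  proof (rule sum_norm_le)
    fix i assume i: "i \<in> {1..n}"
    have "norm ((1 / real n) *\<^sub>R (gradient (f i) x - gradient (f i) y))
        \<le> (1 / real n) * (L i * norm (x - y))"
      using gradient_f_lipschitz[OF i, of x y] by (simp add: divide_right_mono)
    also have "\<dots> = L i / real n * norm (x - y)"
      by simp
    also have "\<dots> \<le> Lt * pmf P i * norm (x - y)"
      by (intro mult_right_mono L_le i) auto
    finally show "norm ((1 / real n) *\<^sub>R (gradient (f i) x - gradient (f i) y))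
        \<le> Lt * pmf P i * norm (x - y)" .
  qed
  also have "\<dots> = Lt * norm (x - y)"
    using sum_P by (simp add: sum_distrib_left[symmetric] sum_distrib_right[symmetric])
  finally show ?thesis .
qed

section \<open>The variance-reduced gradient\<close>

abbreviation "v xt i x \<equiv> vr_gradient n P f xt i x"

lemma vr_gradient_unbiased: "(\<Sum>i=1..n. pmf P i *\<^sub>R v xt i x) = gradient favg x"
proof -
  have "(\<Sum>i=1..n. pmf P i *\<^sub>R v xt i x)
      = (\<Sum>i=1..n. (1 / real n) *\<^sub>R (gradient (f i) x - gradient (f i) xt) + pmf P i *\<^sub>R gradient favg xt)"
    using pmf_P_pos by (intro sum.cong refl) (force simp: vr_gradient_def scaleR_add_right)
  also have "\<dots> = (\<Sum>i=1..n. (1 / real n) *\<^sub>R (gradient (f i) x - gradient (f i) xt))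
      + (\<Sum>i=1..n. pmf P i) *\<^sub>R gradient favg xt"
    by (simp only: sum.distrib scaleR_sum_left)
  also have "(\<Sum>i=1..n. (1 / real n) *\<^sub>R (gradient (f i) x - gradient (f i) xt))
      = gradient favg x - gradient favg xt"
    by (simp add: gradient_favg scaleR_right_diff_distrib sum_subtractf scaleR_sum_right)
  finally show ?thesis
    by (simp only: sum_P) simp
qed

text \<open>The full gradient at the snapshot is a constant shift, so the variance is at most the
  second moment of the reweighted differences. Each of these is bounded by the Bregman divergence of
  its component, and the component divergences average to that of \<open>favg\<close>.\<close>

lemma vr_gradient_variance:
  "(\<Sum>i=1..n. pmf P i * (norm (gradient favg x - v xt i x))\<^sup>2)
    \<le> 2 * Lt * (favg xt - favg x - gradient favg x \<bullet> (xt - x))"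
proof -
  define d where "d i = gradient (f i) x - gradient (f i) xt" for i
  define a where "a i = (1 / (real n * pmf P i)) *\<^sub>R d i" for i
  define D where "D i = f i xt - f i x - gradient (f i) x \<bullet> (xt - x)" for i
  have v_eq: "v xt i x = a i + gradient favg xt" for i
    by (simp add: vr_gradient_def a_def d_def)
  have mean: "(\<Sum>i=1..n. pmf P i *\<^sub>R a i) = gradient favg x - gradient favg xt"
    using vr_gradient_unbiased[of xt x] sum_P
    by (simp add: v_eq scaleR_add_right sum.distrib scaleR_sum_left[symmetric] eq_diff_eq)
  have "gradient favg x - v xt i x = - (a i - (\<Sum>j=1..n. pmf P j *\<^sub>R a j))" for i
    unfolding mean by (simp add: v_eq)
  then have "(\<Sum>i=1..n. pmf P i * (norm (gradient favg x - v xt i x))\<^sup>2)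
      = (\<Sum>i=1..n. pmf P i * (norm (a i - (\<Sum>j=1..n. pmf P j *\<^sub>R a j)))\<^sup>2)"
    by (simp only: norm_minus_cancel)
  also have "\<dots> \<le> (\<Sum>i=1..n. pmf P i * (norm (a i))\<^sup>2)"
    by (rule weighted_variance_le_second_moment) (rule sum_P)
  also have "\<dots> \<le> (\<Sum>i=1..n. 2 * Lt * ((1 / real n) * D i))"
  proof (rule sum_mono)
    fix i assume i: "i \<in> {1..n}"
    have p: "pmf P i > 0" and n: "real n > 0"
      using pmf_P_pos[OF i] n_pos by auto
    have D: "(norm (d i))\<^sup>2 \<le> 2 * L i * D i"
      unfolding d_def D_def
      by (rule gradient_diff_norm_le_bregman[OF f_convex GDERIV_f gradient_f_lipschitz L_pos]) (rule i)+
    then have "0 \<le> 2 * L i * D i"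
      by (rule order_trans[OF zero_le_power2])
    then have D0: "D i \<ge> 0"
      using L_pos[OF i] by (simp add: zero_le_mult_iff)
    have "pmf P i * (norm (a i))\<^sup>2 = (norm (d i))\<^sup>2 / ((real n)\<^sup>2 * pmf P i)"
      using p n by (simp add: a_def power_mult_distrib power_divide power2_eq_square)
    also have "\<dots> \<le> 2 * L i * D i / ((real n)\<^sup>2 * pmf P i)"
      using p n D by (intro divide_right_mono) auto
    \<comment> \<open>One factor 1/n is paired with \<open>L i\<close>, so that \<open>L_le\<close>
      applies and the probability in the denominator cancels.\<close>
    also have "\<dots> = (L i / real n) * (2 * D i / (real n * pmf P i))"
      by (simp add: power2_eq_square mult_ac)
    also have "\<dots> \<le> (Lt * pmf P i) * (2 * D i / (real n * pmf P i))"
      using p n D0 by (intro mult_right_mono L_le i) auto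
    also have "\<dots> = 2 * Lt * ((1 / real n) * D i)"
      using p by simp
    finally show "pmf P i * (norm (a i))\<^sup>2 \<le> 2 * Lt * ((1 / real n) * D i)" .
  qed
  also have "\<dots> = 2 * Lt * (favg xt - favg x - gradient favg x \<bullet> (xt - x))"
    by (simp add: sum_distrib_left[symmetric] sum_divide_distrib[symmetric] D_def sum_subtractf
        average_def gradient_favg inner_sum_left diff_divide_distrib)
  finally show ?thesis .
qed

section \<open>A single inner iteration\<close>

lemma prox_step_three_point:
  fixes u y z :: "real ^ 'd"
  assumes w: "w > 0"
  defines "y' \<equiv> prox_step g \<eta> w u y"
  shows "u \<bullet> (y' - y) + w / (2 * \<eta>) * (norm (y' - y))\<^sup>2 + g y' + w / (2 * \<eta>) * (norm (z - y'))\<^sup>2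
    \<le> u \<bullet> (z - y) + w / (2 * \<eta>) * (norm (z - y))\<^sup>2 + g z"
proof -
  define h where "h q = u \<bullet> (q - y) + g q" for q
  define k where "k = w / (2 * \<eta>)"
  have lin: "convex_on UNIV (\<lambda>q. u \<bullet> (q - y))"
  proof (rule convex_onI)
    fix t :: real and p q :: "real ^ 'd"
    have "(1 - t) *\<^sub>R p + t *\<^sub>R q - y = (1 - t) *\<^sub>R (p - y) + t *\<^sub>R (q - y)"
      by (simp add: algebra_simps)
    then show "u \<bullet> ((1 - t) *\<^sub>R p + t *\<^sub>R q - y) \<le> (1 - t) * (u \<bullet> (p - y)) + t * (u \<bullet> (q - y))"
      by (simp only: inner_add_right inner_scaleR_right order_refl)
  qed simp
  have conv: "convex_on UNIV h"
    unfolding h_def[abs_def] by (intro convex_on_add lin g_convex)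
  have k: "k > 0"
    using w eta_pos by (simp add: k_def)
  obtain z0 where z0: "\<And>q. h z0 + k * (norm (z0 - y))\<^sup>2 \<le> h q + k * (norm (q - y))\<^sup>2"
    using convex_plus_quadratic_has_minimum[OF conv k] by blast
  have obj: "(\<lambda>q. u \<bullet> (q - y) + w / (2 * \<eta>) * (norm (q - y))\<^sup>2 + g q) = (\<lambda>q. h q + k * (norm (q - y))\<^sup>2)"
    by (simp add: h_def k_def fun_eq_iff)
  \<comment> \<open>\<open>arg_min\<close> is a choice operator; existence of a minimizer shows that
    the chosen point attains the minimal value, which is all the three-point inequality
    needs.\<close>
  have "h y' + k * (norm (y' - y))\<^sup>2 = h z0 + k * (norm (z0 - y))\<^sup>2"
    unfolding y'_def prox_step_def obj by (rule arg_min_equality) (auto intro: z0)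
  with z0 have "h y' + k * (norm (y' - y))\<^sup>2 \<le> h q + k * (norm (q - y))\<^sup>2" for q
    by simp
  from convex_plus_quadratic_three_point[OF conv this, of z] show ?thesis
    by (simp add: h_def k_def)
qed


text \<open>Deterministic, for an arbitrary estimate \<open>u\<close> of the gradient; the error
  enters only through its squared norm, ready for the variance bound.\<close>

lemma average_gradient_step_bound:
  assumes w: "0 < w" "w \<le> 1" and x: "x = xt + w *\<^sub>R (y - xt)"
    and y': "y' = prox_step g \<eta> w u y" and x': "x' = xt + w *\<^sub>R (y' - xt)"
  shows "F x' + w\<^sup>2 / (2 * \<eta>) * (norm (z - y'))\<^sup>2
    \<le> favg x + \<beta> / (2 * Lt) * (norm (gradient favg x - u))\<^sup>2 + w * (u \<bullet> (z - y))
      + w\<^sup>2 / (2 * \<eta>) * (norm (z - y))\<^sup>2 + w * g z + (1 - w) * g xt"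
proof -
  define e where "e = gradient favg x - u"
  \<comment> \<open>The parameter in Young's inequality is fixed by Lt + k = \<alpha> * Lt = 1 /
    \<eta>: the two quadratic terms then sum to \<open>w\<close> times the quadratic of the proximal
    step, and 1 / k = \<beta> / Lt.\<close>
  define k where "k = Lt * (\<alpha> - 1)"
  have k: "k > 0"
    using Lt_pos alpha_gt by (simp add: k_def)
  have step: "x' - x = w *\<^sub>R (y' - y)"
    by (simp add: x x' algebra_simps)
  have descent: "favg x' \<le> favg x + gradient favg x \<bullet> (x' - x) + Lt / 2 * (norm (x' - x))\<^sup>2"
    by (rule descent_lemma[OF GDERIV_favg gradient_favg_lipschitz])
  have young: "e \<bullet> (x' - x) \<le> 1 / (2 * k) * (norm e)\<^sup>2 + k / 2 * (norm (x' - x))\<^sup>2"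
  proof -
    have "(norm (e - k *\<^sub>R d))\<^sup>2 = (norm e)\<^sup>2 - 2 * k * (e \<bullet> d) + k\<^sup>2 * (norm d)\<^sup>2" for d
      unfolding power2_norm_eq_inner
      by (simp add: inner_diff_left inner_diff_right inner_commute[of d e] power2_eq_square algebra_simps)
    then have "0 \<le> (norm e)\<^sup>2 - 2 * k * (e \<bullet> (x' - x)) + k\<^sup>2 * (norm (x' - x))\<^sup>2"
      by (metis zero_le_power2)
    then show ?thesis
      using k by (simp add: field_simps power2_eq_square)
  qed
  have quad: "Lt / 2 * (norm (x' - x))\<^sup>2 + k / 2 * (norm (x' - x))\<^sup>2
      = w * (w / (2 * \<eta>) * (norm (y' - y))\<^sup>2)"
  proof -
    have "Lt / 2 + k / 2 = 1 / (2 * \<eta>)"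
      using eta_pos alpha_gt by (simp add: k_def Lt_eq field_simps)
    then have "Lt / 2 * (norm (x' - x))\<^sup>2 + k / 2 * (norm (x' - x))\<^sup>2 = 1 / (2 * \<eta>) * (norm (x' - x))\<^sup>2"
      by (metis distrib_right)
    then show ?thesis
      by (simp add: step power_mult_distrib power2_eq_square)
  qed
  have "gradient favg x \<bullet> (x' - x) = e \<bullet> (x' - x) + w * (u \<bullet> (y' - y))"
    by (simp add: e_def step inner_diff_left algebra_simps)
  with descent young quad have smooth: "favg x' \<le> favg x + 1 / (2 * k) * (norm e)\<^sup>2
      + w * (u \<bullet> (y' - y) + w / (2 * \<eta>) * (norm (y' - y))\<^sup>2)"
    by (simp add: distrib_left)
  have "w * (u \<bullet> (y' - y) + w / (2 * \<eta>) * (norm (y' - y))\<^sup>2 + g y' + w / (2 * \<eta>) * (norm (z - y'))\<^sup>2)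
      \<le> w * (u \<bullet> (z - y) + w / (2 * \<eta>) * (norm (z - y))\<^sup>2 + g z)"
    unfolding y' using w by (intro mult_left_mono prox_step_three_point) auto
  moreover have "x' = (1 - w) *\<^sub>R xt + w *\<^sub>R y'"
    by (simp add: x' algebra_simps)
  then have "g x' \<le> (1 - w) * g xt + w * g y'"
    using w by (auto intro!: convex_onD[OF g_convex])
  moreover have "w\<^sup>2 / (2 * \<eta>) = w * (w / (2 * \<eta>))"
    by (simp add: power2_eq_square)
  moreover have "1 / (2 * k) = \<beta> / (2 * Lt)"
    by (simp add: k_def)
  ultimately show ?thesis
    using smooth unfolding objective_def e_def[symmetric]
    by (simp only: distrib_left mult.assoc)
qed

lemma inner_step_expectation:
  assumes w: "0 < w" "w \<le> 1 - \<beta>" and x: "x = xt + w *\<^sub>R (y - xt)"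
  defines "y' i \<equiv> prox_step g \<eta> w (v xt i x) y"
  defines "x' i \<equiv> xt + w *\<^sub>R (y' i - xt)"
  shows "(\<Sum>i=1..n. pmf P i * (F (x' i) + w\<^sup>2 / (2 * \<eta>) * (norm (z - y' i))\<^sup>2))
    \<le> (1 - w) * F xt + w * F z + w\<^sup>2 / (2 * \<eta>) * (norm (z - y))\<^sup>2"
proof -
  define G where "G = gradient favg x"
  define R where "R = favg x + w\<^sup>2 / (2 * \<eta>) * (norm (z - y))\<^sup>2 + w * g z + (1 - w) * g xt"
  have \<beta>: "\<beta> > 0"
    using alpha_gt by simp
  then have w1: "w \<le> 1"
    using w by linarith
  have "(\<Sum>i=1..n. pmf P i * (F (x' i) + w\<^sup>2 / (2 * \<eta>) * (norm (z - y' i))\<^sup>2))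
      \<le> (\<Sum>i=1..n. pmf P i * (R + \<beta> / (2 * Lt) * (norm (G - v xt i x))\<^sup>2 + w * (v xt i x \<bullet> (z - y))))"
  proof (intro sum_mono mult_left_mono)
    fix i
    show "F (x' i) + w\<^sup>2 / (2 * \<eta>) * (norm (z - y' i))\<^sup>2
        \<le> R + \<beta> / (2 * Lt) * (norm (G - v xt i x))\<^sup>2 + w * (v xt i x \<bullet> (z - y))"
      using average_gradient_step_bound[OF w(1) w1 x, where u = "v xt i x" and y' = "y' i" and x' = "x' i" and z = z]
      by (simp add: R_def G_def y'_def x'_def add_ac)
  qed simp
  also have "\<dots> = (\<Sum>i=1..n. pmf P i) * R
      + \<beta> / (2 * Lt) * (\<Sum>i=1..n. pmf P i * (norm (G - v xt i x))\<^sup>2)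
      + w * ((\<Sum>i=1..n. pmf P i *\<^sub>R v xt i x) \<bullet> (z - y))"
    by (simp add: distrib_left sum.distrib sum_distrib_left sum_distrib_right inner_sum_left
        mult.left_commute)
  also have "\<dots> = R + \<beta> / (2 * Lt) * (\<Sum>i=1..n. pmf P i * (norm (G - v xt i x))\<^sup>2) + w * (G \<bullet> (z - y))"
    by (simp only: sum_P vr_gradient_unbiased G_def mult_1)
  also have "\<dots> \<le> R + \<beta> / (2 * Lt) * (2 * Lt * (favg xt - favg x - G \<bullet> (xt - x))) + w * (G \<bullet> (z - y))"
    using \<beta> Lt_pos unfolding G_def
    by (intro add_mono mult_left_mono vr_gradient_variance order_refl) auto
  also have "\<beta> / (2 * Lt) * (2 * Lt * (favg xt - favg x - G \<bullet> (xt - x)))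
      = \<beta> * (favg xt - favg x - G \<bullet> (xt - x))"
    using Lt_pos by simp
  also have "w * (G \<bullet> (z - y)) = w * (G \<bullet> (z - x)) + (1 - w) * (G \<bullet> (xt - x))"
  proof -
    have "w *\<^sub>R (z - y) = w *\<^sub>R (z - x) + (1 - w) *\<^sub>R (xt - x)"
      by (simp add: x algebra_simps)
    then show ?thesis
      by (metis inner_add_right inner_scaleR_right)
  qed
  finally have bound: "(\<Sum>i=1..n. pmf P i * (F (x' i) + w\<^sup>2 / (2 * \<eta>) * (norm (z - y' i))\<^sup>2))
      \<le> R + \<beta> * (favg xt - favg x) + w * (G \<bullet> (z - x)) + (1 - w - \<beta>) * (G \<bullet> (xt - x))"
    by (simp add: algebra_simps)
  \<comment> \<open>Applied at \<open>z\<close> with weight \<open>w\<close> and at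
    \<open>xt\<close> with weight 1 - w - \<beta>; the latter is nonnegative by the assumed upper
    bound on \<open>w\<close>.\<close>
  have "G \<bullet> (q - x) \<le> favg q - favg x" for q
    using convex_above_tangent_plane[OF convex_favg GDERIV_favg, of x q] by (simp add: G_def)
  then have "w * (G \<bullet> (z - x)) \<le> w * (favg z - favg x)"
      "(1 - w - \<beta>) * (G \<bullet> (xt - x)) \<le> (1 - w - \<beta>) * (favg xt - favg x)"
    using w by (intro mult_left_mono; simp)+
  moreover have "R + \<beta> * (favg xt - favg x) + w * (favg z - favg x) + (1 - w - \<beta>) * (favg xt - favg x)
      = (1 - w) * F xt + w * F z + w\<^sup>2 / (2 * \<eta>) * (norm (z - y))\<^sup>2"
    unfolding R_def objective_def by algebra
  ultimately show ?thesis
    using bound by linarith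
qed

section \<open>One epoch\<close>

abbreviation "epoch_law w xt yt t \<equiv> asvrg_inner n P f g \<eta> w xt yt t"

lemma finite_inner: "finite (set_pmf (epoch_law w xt yt t))"
  by (induction t) (auto simp: finite_P Let_def split: prod.splits)

text \<open>The state stores \<open>x\<close> and \<open>y\<close> as separate components; the
  one-step bound needs their coupling, which holds at every point of the support.\<close>

lemma inner_support:
  "(x, y, a) \<in> set_pmf (epoch_law w xt yt t) \<Longrightarrow> x = xt + w *\<^sub>R (y - xt) \<and> (t = 0 \<longrightarrow> a = 0)"
  by (cases t) (auto simp: Let_def algebra_simps)

text \<open>Jensen's inequality in incremental form: the new average is a convex combination with
  weight 1 / (t + 1) on \<open>b\<close>. For t = 0 the old average is multiplied by 0 and
  \<open>a\<close> vanishes, leaving equality.\<close>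

lemma scaled_average_step:
  assumes "t = 0 \<longrightarrow> a = 0"
  shows "real (Suc t) * F ((1 / real (Suc t)) *\<^sub>R (a + b)) \<le> real t * F ((1 / real t) *\<^sub>R a) + F b"
proof (cases "t = 0")
  case False
  define \<theta> where "\<theta> = 1 / real (Suc t)"
  have \<theta>: "real (Suc t) * (1 - \<theta>) = real t" "real (Suc t) * \<theta> = 1"
    by (simp_all add: \<theta>_def field_simps)
  have avg: "(1 / real (Suc t)) *\<^sub>R (a + b) = (1 - \<theta>) *\<^sub>R ((1 / real t) *\<^sub>R a) + \<theta> *\<^sub>R b"
    using False by (simp add: \<theta>_def scaleR_add_right field_simps)
  have "F ((1 / real (Suc t)) *\<^sub>R (a + b)) \<le> (1 - \<theta>) * F ((1 / real t) *\<^sub>R a) + \<theta> * F b"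
    unfolding avg by (rule convex_onD[OF convex_F]) (auto simp: \<theta>_def)
  then have "real (Suc t) * F ((1 / real (Suc t)) *\<^sub>R (a + b))
      \<le> real (Suc t) * ((1 - \<theta>) * F ((1 / real t) *\<^sub>R a) + \<theta> * F b)"
    by (intro mult_left_mono) auto
  also have "\<dots> = real t * F ((1 / real t) *\<^sub>R a) + F b"
    by (simp only: distrib_left mult.assoc[symmetric] \<theta>)
  finally show ?thesis .
qed (use assms in simp)

text \<open>The law does not record the individual iterates, only their sum \<open>a\<close>; the invariant therefore
  carries \<open>t * F (a / t)\<close> in place of the sum of the objective values.\<close>
lemma inner_potential:
  assumes w: "0 < w" "w \<le> 1 - \<beta>"
  shows "measure_pmf.expectation (epoch_law w xt yt t)
      (\<lambda>(x, y, a). real t * (F ((1 / real t) *\<^sub>R a) - F x_star) + w\<^sup>2 / (2 * \<eta>) * (norm (x_star - y))\<^sup>2)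
    \<le> real t * ((1 - w) * (F xt - F x_star)) + w\<^sup>2 / (2 * \<eta>) * (norm (x_star - yt))\<^sup>2"
proof (induction t)
  case (Suc t)
  let ?V = "\<lambda>t (x, y, a). real t * (F ((1 / real t) *\<^sub>R a) - F x_star)
    + w\<^sup>2 / (2 * \<eta>) * (norm (x_star - y))\<^sup>2"
  let ?y = "\<lambda>x y i. prox_step g \<eta> w (v xt i x) y"
  let ?x = "\<lambda>x y i. xt + w *\<^sub>R (?y x y i - xt)"
  let ?next = "\<lambda>(x, y, a). bind_pmf P (\<lambda>i. return_pmf (?x x y i, ?y x y i, a + ?x x y i))"
  have step: "measure_pmf.expectation (?next q) (?V (Suc t)) \<le> ?V t q + (1 - w) * (F xt - F x_star)"
    if q_in: "q \<in> set_pmf (epoch_law w xt yt t)" for q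
  proof -
    obtain x y a where q: "q = (x, y, a)"
      by (cases q)
    have supp: "x = xt + w *\<^sub>R (y - xt)" "t = 0 \<longrightarrow> a = 0"
      using inner_support q_in unfolding q by blast+
    have "measure_pmf.expectation (?next q) (?V (Suc t))
        = (\<Sum>i=1..n. pmf P i * ?V (Suc t) (?x x y i, ?y x y i, a + ?x x y i))"
      by (simp add: q expectation_bind_pmf finite_P expectation_P)
    \<comment> \<open>This separates a part independent of the drawn index from exactly the sum that
      \<open>inner_step_expectation\<close> bounds.\<close>
    also have "\<dots> \<le> (\<Sum>i=1..n. pmf P i * (real t * (F ((1 / real t) *\<^sub>R a) - F x_star) - F x_star
        + (F (?x x y i) + w\<^sup>2 / (2 * \<eta>) * (norm (x_star - ?y x y i))\<^sup>2)))"
    proof (intro sum_mono mult_left_mono)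
      fix i
      show "?V (Suc t) (?x x y i, ?y x y i, a + ?x x y i)
          \<le> real t * (F ((1 / real t) *\<^sub>R a) - F x_star) - F x_star
            + (F (?x x y i) + w\<^sup>2 / (2 * \<eta>) * (norm (x_star - ?y x y i))\<^sup>2)"
        using scaled_average_step[OF supp(2), of "?x x y i"] by (simp add: algebra_simps)
    qed simp
    also have "\<dots> = (\<Sum>i=1..n. pmf P i) * (real t * (F ((1 / real t) *\<^sub>R a) - F x_star) - F x_star)
        + (\<Sum>i=1..n. pmf P i * (F (?x x y i) + w\<^sup>2 / (2 * \<eta>) * (norm (x_star - ?y x y i))\<^sup>2))"
      by (simp only: distrib_left[of "pmf P _"] sum.distrib sum_distrib_right)
    also have "\<dots> \<le> real t * (F ((1 / real t) *\<^sub>R a) - F x_star) - F x_star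
        + ((1 - w) * F xt + w * F x_star + w\<^sup>2 / (2 * \<eta>) * (norm (x_star - y))\<^sup>2)"
      using inner_step_expectation[OF w supp(1), of x_star] by (simp add: sum_P[simplified])
    also have "\<dots> = ?V t q + (1 - w) * (F xt - F x_star)"
      by (simp add: q algebra_simps)
    finally show ?thesis .
  qed
  have "measure_pmf.expectation (epoch_law w xt yt (Suc t)) (?V (Suc t))
      = measure_pmf.expectation (bind_pmf (epoch_law w xt yt t) ?next) (?V (Suc t))"
    by (simp add: Let_def)
  also have "\<dots> = measure_pmf.expectation (epoch_law w xt yt t)
      (\<lambda>q. measure_pmf.expectation (?next q) (?V (Suc t)))"
    by (rule expectation_bind_pmf) (auto simp: finite_inner finite_P)
  also have "\<dots> \<le> measure_pmf.expectation (epoch_law w xt yt t) (\<lambda>q. ?V t q + (1 - w) * (F xt - F x_star))"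
    by (rule expectation_mono_pmf[OF finite_inner step])
  also have "\<dots> = measure_pmf.expectation (epoch_law w xt yt t) (?V t) + (1 - w) * (F xt - F x_star)"
    by (subst Bochner_Integration.integral_add)
      (auto intro: integrable_measure_pmf_finite finite_inner)
  finally show ?case
    using Suc.IH by (simp add: algebra_simps)
qed simp

section \<open>The momentum sequence\<close>

lemma momentum_0: "\<omega> 0 = 1 - \<beta>"
  unfolding momentum.simps Lt_eta using alpha_gt by (simp add: field_simps)

lemma momentum_pos: "\<omega> s > 0"
proof (induction s)
  case 0
  show ?case
    unfolding momentum_0 using alpha_gt by (simp add: field_simps)
next
  case (Suc s)
  then show ?case
    by (rule momentum_step(1)) simp
qed

text \<open>Since the sequence decreases from 1 - \<beta>, the one-step bound is available in every
  epoch.\<close>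

lemma momentum_le: "\<omega> s \<le> 1 - \<beta>"
proof (induction s)
  case (Suc s)
  then show ?case
    using momentum_step(2)[OF momentum_pos[of s], of "\<omega> (Suc s)"] by simp
qed (simp only: momentum_0 order_refl)

lemma momentum_ratio: "(1 - \<omega> (Suc s)) / (\<omega> (Suc s))\<^sup>2 = 1 / (\<omega> s)\<^sup>2"
  by (rule momentum_step(3)[OF momentum_pos]) simp

lemma inverse_momentum_ge: "1 / \<omega> s \<ge> (real s + 2) / 2"
proof (induction s)
  case 0
  have "\<omega> 0 \<le> 1"
    unfolding momentum_0 using alpha_gt by simp
  then show ?case
    using momentum_pos[of 0] by simp
next
  case (Suc s)
  then show ?case
    using momentum_step(4)[OF momentum_pos[of s], of "\<omega> (Suc s)"] by (simp add: field_simps)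
qed

section \<open>Telescoping over the epochs\<close>

context
  fixes m :: nat and x0 :: "real ^ 'd"
  assumes m: "m \<ge> 1"
begin

abbreviation "outer s \<equiv> asvrg n P f L g \<eta> m x0 s"

lemma finite_outer: "finite (set_pmf (outer s))"
  by (induction s) (auto simp: finite_inner split: prod.splits)

text \<open>The inner potential bound is multiplied by
  \<open>c = 1 / (m * \<omega>\<^sub>s\<^sup>2)\<close>, which makes the coefficient of the squared
  distance the same in all epochs.\<close>

lemma epoch_step:
  "measure_pmf.expectation (epoch_law (\<omega> s) xt yt m)
      (\<lambda>(x, y, a). 1 / (\<omega> s)\<^sup>2 * (F ((1 / real m) *\<^sub>R a) - F x_star)
        + 1 / (2 * \<eta> * real m) * (norm (x_star - y))\<^sup>2)
    \<le> (1 - \<omega> s) / (\<omega> s)\<^sup>2 * (F xt - F x_star) + 1 / (2 * \<eta> * real m) * (norm (x_star - yt))\<^sup>2"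
proof -
  define c where "c = 1 / (real m * (\<omega> s)\<^sup>2)"
  have pos: "\<omega> s > 0" "real m > 0"
    using momentum_pos m by auto
  have c1: "c * (real m * r) = 1 / (\<omega> s)\<^sup>2 * r" for r
    using pos by (simp add: c_def)
  have c2: "c * ((\<omega> s)\<^sup>2 / (2 * \<eta>) * r) = 1 / (2 * \<eta> * real m) * r" for r
    using pos eta_pos by (simp add: c_def)
  have "measure_pmf.expectation (epoch_law (\<omega> s) xt yt m)
      (\<lambda>(x, y, a). 1 / (\<omega> s)\<^sup>2 * (F ((1 / real m) *\<^sub>R a) - F x_star)
        + 1 / (2 * \<eta> * real m) * (norm (x_star - y))\<^sup>2)
    = measure_pmf.expectation (epoch_law (\<omega> s) xt yt m) (\<lambda>q. c * (case q of (x, y, a) \<Rightarrow>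
        real m * (F ((1 / real m) *\<^sub>R a) - F x_star) + (\<omega> s)\<^sup>2 / (2 * \<eta>) * (norm (x_star - y))\<^sup>2))"
    by (simp only: prod.case_distrib[of "\<lambda>r. c * r"] distrib_left[of c] c1 c2)
  also have "\<dots> \<le> c * (real m * ((1 - \<omega> s) * (F xt - F x_star))
      + (\<omega> s)\<^sup>2 / (2 * \<eta>) * (norm (x_star - yt))\<^sup>2)"
    using inner_potential[OF momentum_pos momentum_le] pos
    by (simp add: c_def mult_left_mono divide_right_mono)
  also have "\<dots> = (1 - \<omega> s) / (\<omega> s)\<^sup>2 * (F xt - F x_star) + 1 / (2 * \<eta> * real m) * (norm (x_star - yt))\<^sup>2"
    by (simp only: distrib_left[of c] c1 c2) simp
  finally show ?thesis .
qed

text \<open>By \<open>momentum_ratio\<close>, the weight of the gap at the end of an epoch is the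
  weight at the start of the next one, so the potential does not increase in expectation.\<close>

lemma outer_potential:
  "measure_pmf.expectation (outer s) (\<lambda>(xt, yt). (1 - \<omega> s) / (\<omega> s)\<^sup>2 * (F xt - F x_star)
      + 1 / (2 * \<eta> * real m) * (norm (x_star - yt))\<^sup>2)
    \<le> (1 - \<omega> 0) / (\<omega> 0)\<^sup>2 * (F x0 - F x_star) + 1 / (2 * \<eta> * real m) * (norm (x_star - x0))\<^sup>2"
proof (induction s)
  case (Suc s)
  let ?W = "\<lambda>(xt, yt). 1 / (\<omega> s)\<^sup>2 * (F xt - F x_star) + 1 / (2 * \<eta> * real m) * (norm (x_star - yt))\<^sup>2"
  let ?next = "\<lambda>(xt, yt). map_pmf (\<lambda>(x, y, a). ((1 / real m) *\<^sub>R a, y)) (epoch_law (\<omega> s) xt yt m)"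
  have "measure_pmf.expectation (outer (Suc s)) ?W = measure_pmf.expectation (outer s)
      (\<lambda>q. measure_pmf.expectation (?next q) ?W)"
    unfolding asvrg.simps by (rule expectation_bind_pmf) (auto simp: finite_outer finite_inner)
  also have "\<dots> \<le> measure_pmf.expectation (outer s) (\<lambda>(xt, yt).
      (1 - \<omega> s) / (\<omega> s)\<^sup>2 * (F xt - F x_star) + 1 / (2 * \<eta> * real m) * (norm (x_star - yt))\<^sup>2)"
    using epoch_step[of s]
    by (intro expectation_mono_pmf finite_outer)
      (auto simp: case_prod_unfold simp del: momentum.simps)
  also note Suc.IH
  finally show ?case
    unfolding momentum_ratio .
qed simp

lemma suboptimality_bound:
  assumes S: "S \<ge> 1"
  shows "measure_pmf.expectation (asvrg_output n P f L g \<eta> m x0 S) (\<lambda>x. F x - F x_star)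
    \<le> 4 * (\<alpha> - 1) * (F x0 - F x_star) / ((\<alpha> - 2)\<^sup>2 * (real S + 1)\<^sup>2)
      + 2 * (norm (x_star - x0))\<^sup>2 / (\<eta> * real m * (real S + 1)\<^sup>2)"
proof -
  \<comment> \<open>The gap after epoch \<open>S\<close> carries the weight
    \<open>1 / \<omega>\<^sub>s\<^sup>2\<close> with s = S - 1; since 1 / \<omega> s \<ge> (s + 2) /
    2, this is the source of S + 1 in the rate.\<close>
  obtain s where s: "S = Suc s"
    using S by (cases S) auto
  let ?E = "measure_pmf.expectation (outer S) (\<lambda>(xt, yt). F xt - F x_star)"
  define B where "B = (\<alpha> - 1) / (\<alpha> - 2)\<^sup>2 * (F x0 - F x_star)
    + 1 / (2 * \<eta> * real m) * (norm (x_star - x0))\<^sup>2"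
  \<comment> \<open>Needed below to replace the weight of the expected gap by a lower bound.\<close>
  have E0: "?E \<ge> 0"
    by (rule Bochner_Integration.integral_nonneg) (auto simp: F_min)
  have "1 / (\<omega> s)\<^sup>2 * ?E = measure_pmf.expectation (outer S) (\<lambda>q. 1 / (\<omega> s)\<^sup>2 * (case q of (xt, yt) \<Rightarrow> F xt - F x_star))"
    by (rule Bochner_Integration.integral_mult_right_zero[symmetric])
  also have "\<dots> \<le> measure_pmf.expectation (outer S) (\<lambda>(xt, yt). (1 - \<omega> S) / (\<omega> S)\<^sup>2 * (F xt - F x_star)
      + 1 / (2 * \<eta> * real m) * (norm (x_star - yt))\<^sup>2)"
    unfolding s momentum_ratio using eta_pos
    by (intro expectation_mono_pmf finite_outer) (auto split: prod.splits)
  also have "\<dots> \<le> (1 - \<omega> 0) / (\<omega> 0)\<^sup>2 * (F x0 - F x_star) + 1 / (2 * \<eta> * real m) * (norm (x_star - x0))\<^sup>2"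
    by (rule outer_potential)
  also have "(1 - \<omega> 0) / (\<omega> 0)\<^sup>2 = (\<alpha> - 1) / (\<alpha> - 2)\<^sup>2"
  proof -
    have "\<omega> 0 = (\<alpha> - 2) / (\<alpha> - 1)" "1 - \<omega> 0 = 1 / (\<alpha> - 1)"
      unfolding momentum_0 using alpha_gt by (simp_all add: field_simps)
    then show ?thesis
      using alpha_gt by (simp only: power_divide) (simp add: power2_eq_square)
  qed
  finally have weighted: "1 / (\<omega> s)\<^sup>2 * ?E \<le> B"
    by (simp only: B_def)
  have "((real S + 1) / 2)\<^sup>2 \<le> (1 / \<omega> s)\<^sup>2"
    using inverse_momentum_ge[of s] by (intro power_mono) (auto simp: s)
  then have "((real S + 1) / 2)\<^sup>2 * ?E \<le> 1 / (\<omega> s)\<^sup>2 * ?E"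
    using E0 by (intro mult_right_mono) (simp_all add: power_divide)
  with weighted have "((real S + 1) / 2)\<^sup>2 * ?E \<le> B"
    by linarith
  then have "?E \<le> B * (4 / (real S + 1)\<^sup>2)"
    by (simp add: power_divide field_simps)
  also have "\<dots> = 4 * (\<alpha> - 1) * (F x0 - F x_star) / ((\<alpha> - 2)\<^sup>2 * (real S + 1)\<^sup>2)
      + 2 * (norm (x_star - x0))\<^sup>2 / (\<eta> * real m * (real S + 1)\<^sup>2)"
  proof -
    have "A / P * G * (4 / X) + 1 / (2 * e * M) * N * (4 / X) = 4 * A * G / (P * X) + 2 * N / (e * M * X)"
      for A P G X e M N :: real
      by (simp add: mult_ac)
    then show ?thesis
      by (simp only: B_def distrib_right)
  qed
  finally show ?thesis
    by (simp add: asvrg_output_def case_prod_unfold)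
qed

lemma expected_objective:
  "measure_pmf.expectation (asvrg_output n P f L g \<eta> m x0 S) F - F x_star
    = measure_pmf.expectation (asvrg_output n P f L g \<eta> m x0 S) (\<lambda>x. F x - F x_star)"
  by (subst Bochner_Integration.integral_diff)
    (auto intro!: integrable_measure_pmf_finite simp: asvrg_output_def finite_outer)

end

section \<open>Gradient evaluations needed for a given accuracy\<close>

text \<open>The number of epochs is the floor of \<open>T\<close>, whose extra summand \<open>\<Delta>\<close> is there for the case of zero
  epochs: then \<open>T < 1\<close> must already force \<open>F x0 - F x_star \<le> \<epsilon>\<close>, which the other two summands do
  not guarantee for large \<open>\<alpha>\<close>.\<close>
lemma complexity_bound:
  fixes a b \<epsilon> :: real
  assumes a: "a > 0" and am: "a * real n \<le> real m" and mb: "real m \<le> b * real n" and \<epsilon>: "\<epsilon> > 0"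
  shows "\<exists>S. measure_pmf.expectation (asvrg_output n P f L g \<eta> m x0 S) F - F x_star \<le> \<epsilon> \<and>
    real (asvrg_evals n m S) \<le> complexity_const \<alpha> a b *
      (real n * sqrt (F x0 - F x_star) / sqrt \<epsilon> + sqrt (real n * Lt) * norm (x0 - x_star) / sqrt \<epsilon>)"
proof -
  define \<Delta> where "\<Delta> = sqrt (F x0 - F x_star)"
  define r where "r = norm (x0 - x_star)"
  \<comment> \<open>The squares of \<open>p\<close> and \<open>q\<close> are the coefficients of the
    initial gap and of the squared distance in \<open>suboptimality_bound\<close>, up to the factor
    \<open>1 / (S + 1)\<^sup>2\<close>; \<eta> is eliminated through Lt = 1 / (\<alpha> *
    \<eta>).\<close>
  define p where "p = 2 * sqrt (\<alpha> - 1) / (\<alpha> - 2)"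
  define q where "q = sqrt (2 * \<alpha> * Lt / real m)"
  define T where "T = (\<Delta> + p * \<Delta> + q * r) / sqrt \<epsilon>"
  define S where "S = nat \<lfloor>T\<rfloor>"
  have n: "real n > 0"
    using n_pos by simp
  have "real m > 0"
    using a am n by (meson less_le_trans mult_pos_pos)
  then have m: "m \<ge> 1" "real m > 0"
    by auto
  have nn: "\<Delta> \<ge> 0" "p \<ge> 0" "q \<ge> 0" "r \<ge> 0"
    using F_min[of x0] alpha_gt Lt_pos m by (auto simp: \<Delta>_def p_def q_def r_def)
  have \<Delta>2: "\<Delta>\<^sup>2 = F x0 - F x_star"
    using F_min[of x0] by (simp add: \<Delta>_def)
  have p2: "p\<^sup>2 = 4 * (\<alpha> - 1) / (\<alpha> - 2)\<^sup>2"
    using alpha_gt by (simp add: p_def power_divide power_mult_distrib)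
  have q2: "q\<^sup>2 = 2 / (\<eta> * real m)"
    using alpha_gt Lt_pos m eta_pos by (simp add: q_def Lt_eq)
  have "T \<ge> 0"
    using nn \<epsilon> by (auto simp: T_def)
  then have S: "real S \<le> T" "T < real S + 1"
    by (auto simp: S_def)
  have "sqrt \<epsilon> * T < sqrt \<epsilon> * (real S + 1)"
    using S(2) \<epsilon> by (intro mult_strict_left_mono) auto
  moreover have "sqrt \<epsilon> * T = \<Delta> + (p * \<Delta> + q * r)"
    using \<epsilon> by (simp add: T_def)
  ultimately have cover: "\<Delta> + (p * \<Delta> + q * r) < sqrt \<epsilon> * (real S + 1)"
    by simp
  have accuracy: "measure_pmf.expectation (asvrg_output n P f L g \<eta> m x0 S) F - F x_star \<le> \<epsilon>"
  proof (cases "S = 0")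
    case True
    have "\<Delta> \<le> sqrt \<epsilon>"
      using cover mult_nonneg_nonneg[OF nn(2,1)] mult_nonneg_nonneg[OF nn(3,4)] by (simp add: True)
    then have "F x0 - F x_star \<le> \<epsilon>"
      by (simp add: \<Delta>_def)
    then show ?thesis
      by (simp add: True asvrg_output_def)
  next
    case False
    then have "measure_pmf.expectation (asvrg_output n P f L g \<eta> m x0 S) F - F x_star
        \<le> 4 * (\<alpha> - 1) * (F x0 - F x_star) / ((\<alpha> - 2)\<^sup>2 * (real S + 1)\<^sup>2)
          + 2 * (norm (x_star - x0))\<^sup>2 / (\<eta> * real m * (real S + 1)\<^sup>2)"
      unfolding expected_objective[OF m(1)] by (intro suboptimality_bound m) auto
    also have "\<dots> = (p\<^sup>2 * \<Delta>\<^sup>2 + q\<^sup>2 * r\<^sup>2) / (real S + 1)\<^sup>2"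
      by (simp add: p2 q2 \<Delta>2 r_def norm_minus_commute add_divide_distrib)
    also have "\<dots> \<le> \<epsilon>"
    proof -
      \<comment> \<open>A sum of squares of nonnegative terms is at most the square of their sum,
        which \<open>cover\<close> bounds.\<close>
      have "p\<^sup>2 * \<Delta>\<^sup>2 + q\<^sup>2 * r\<^sup>2 \<le> (p * \<Delta> + q * r)\<^sup>2"
        using nn by (simp add: power2_sum power_mult_distrib)
      also have "\<dots> \<le> (sqrt \<epsilon> * (real S + 1))\<^sup>2"
        using cover nn by (intro power_mono) auto
      also have "\<dots> = \<epsilon> * (real S + 1)\<^sup>2"
        using \<epsilon> by (simp add: power_mult_distrib)
      finally show ?thesis
        by (simp add: divide_le_eq)
    qed
    finally show ?thesis .
  qed
  \<comment> \<open>From m \<ge> a * n: the term \<open>n * sqrt (2 * \<alpha> * Lt / m)\<close>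
    loses a factor \<open>sqrt n\<close> and becomes a constant times
    \<open>sqrt (n * Lt)\<close>.\<close>
  have nq: "real n * q \<le> sqrt (2 * \<alpha> / a) * sqrt (real n * Lt)"
  proof -
    have "q \<le> sqrt (2 * \<alpha> * Lt / (a * real n))"
      unfolding q_def using a n m am alpha_gt Lt_pos
      by (intro real_sqrt_le_mono divide_left_mono) auto
    then have "real n * q \<le> sqrt ((real n)\<^sup>2) * sqrt (2 * \<alpha> * Lt / (a * real n))"
      using n by simp
    also have "\<dots> = sqrt (2 * \<alpha> / a * (real n * Lt))"
      unfolding real_sqrt_mult[symmetric] using n by (simp add: power2_eq_square)
    finally show ?thesis
      by (simp only: real_sqrt_mult)
  qed
  define c where "c = 1 + p + sqrt (2 * \<alpha> / a)"
  have c: "1 + p \<le> c" "sqrt (2 * \<alpha> / a) \<le> c"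
    using nn a alpha_gt by (auto simp: c_def)
  have "real (asvrg_evals n m S) = real S * (real n + 2 * real m)"
    by (simp add: asvrg_evals_def)
  \<comment> \<open>Rounding down gives S \<le> T without an additive 1, so no separate term of
    order \<open>n\<close> appears; the cost of an epoch is at most
    \<open>(1 + 2 * b) * n\<close>.\<close>
  also have "\<dots> \<le> T * ((1 + 2 * b) * real n)"
    using S mb nn \<open>T \<ge> 0\<close> by (intro mult_mono) (auto simp: algebra_simps)
  also have "\<dots> = (1 + 2 * b) * ((1 + p) * (real n * \<Delta>) + (real n * q) * r) / sqrt \<epsilon>"
    by (simp add: T_def algebra_simps)
  also have "\<dots> \<le> (1 + 2 * b) * (c * (real n * \<Delta>) + (c * sqrt (real n * Lt)) * r) / sqrt \<epsilon>"
  proof -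
    have "b > 0"
      using mb m n by (metis less_le_trans zero_less_mult_pos2)
    moreover have "real n * q \<le> c * sqrt (real n * Lt)"
      using nq mult_right_mono[OF c(2), of "sqrt (real n * Lt)"] Lt_pos by simp
    ultimately show ?thesis
      using c nn \<epsilon> by (intro divide_right_mono mult_left_mono add_mono mult_right_mono) auto
  qed
  also have "\<dots> = ((1 + 2 * b) * c) * (real n * \<Delta> / sqrt \<epsilon> + sqrt (real n * Lt) * r / sqrt \<epsilon>)"
    by (simp only: distrib_left add_divide_distrib times_divide_eq_right mult.assoc)
  also have "(1 + 2 * b) * c = complexity_const \<alpha> a b"
    by (simp only: complexity_const_def c_def p_def)
  finally show ?thesis
    using accuracy unfolding \<Delta>_def r_def by (intro exI[of _ S] conjI)
qed

end

theorem theorem7: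
  fixes n :: nat and f :: "nat \<Rightarrow> real ^ 'd \<Rightarrow> real" and g :: "real ^ 'd \<Rightarrow> real"
    and L :: "nat \<Rightarrow> real" and P :: "nat pmf" and \<eta> \<alpha> :: real
    and x_star x0 :: "real ^ 'd"
  assumes f_convex: "\<And>i. i \<in> {1..n} \<Longrightarrow> convex_on UNIV (f i)"
    and L_pos: "\<And>i. i \<in> {1..n} \<Longrightarrow> L i > 0"
    and f_smooth: "\<And>i. i \<in> {1..n} \<Longrightarrow> L_smooth (L i) (f i)"
    and g_convex: "convex_on UNIV g"
    and minimizer: "is_arg_min (objective n f g) (\<lambda>_. True) x_star"
    and P_support: "set_pmf P = {1..n}"
    and eta_pos: "\<eta> > 0"
    and alpha_def: "\<alpha> = 1 / (L_tilde n P L * \<eta>)"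
    and alpha_gt: "\<alpha> > 2"
  shows
    "(\<forall>m S :: nat. m \<ge> 1 \<longrightarrow> S \<ge> 1 \<longrightarrow>
        measure_pmf.expectation (asvrg_output n P f L g \<eta> m x0 S)
          (\<lambda>x. objective n f g x - objective n f g x_star)
        \<le> 4 * (\<alpha> - 1) * (objective n f g x0 - objective n f g x_star)
              / ((\<alpha> - 2)\<^sup>2 * (real S + 1)\<^sup>2)
          + 2 * (norm (x_star - x0))\<^sup>2 / (\<eta> * real m * (real S + 1)\<^sup>2)) \<and>
     (\<forall>(m :: nat) a b \<epsilon> :: real. a > 0 \<longrightarrow> a * real n \<le> real m \<longrightarrow> real m \<le> b * real n \<longrightarrow> \<epsilon> > 0 \<longrightarrow>
        (\<exists>S :: nat.
           measure_pmf.expectation (asvrg_output n P f L g \<eta> m x0 S) (objective n f g)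
             - objective n f g x_star \<le> \<epsilon> \<and>
           real (asvrg_evals n m S)
             \<le> complexity_const \<alpha> a b *
               (real n * sqrt (objective n f g x0 - objective n f g x_star) / sqrt \<epsilon>
                + sqrt (real n * L_tilde n P L) * norm (x0 - x_star) / sqrt \<epsilon>)))"
proof -
  interpret asvrg_problem n f g L P \<eta> \<alpha> x_star
    by unfold_locales (fact assms)+
  show ?thesis
    by (intro conjI allI impI suboptimality_bound complexity_bound)
qed

end
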